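(* Let $m\ge 2$ and $s\in[1,m]$ be integers, and let $\pi:\mathbb{F}_2^m\to\mathbb{F}_2^m$ be $\pi(x_1,\dots,x_m)=(x_1+P(x_2,\dots,x_m),x_2,\dots,x_m)$, where $$P(X_2,\dots,X_m)=\sum_{\ell=0}^{m-1}\sum_{2\le i_1<\dots<i_\ell\le m}\alpha_{i_1\cdots i_\ell}X_{i_1}\cdots X_{i_\ell},\qquad \alpha_{i_1\cdots i_\ell}\in\mathbb{F}_2.$$ (A) If $L=\{(x_1,\dots,x_s,0,\dots,0):x_i\in\mathbb{F}_2\}$ (last $m-s$ coordinates zero), then $(\pi,L)$ satisfies the $\mathcal{C}$-condition. (B) If $L=\{(0,\dots,0,x_{s+1},\dots,x_m):x_i\in\mathbb{F}_2\}$ (first $s$ coordinates zero) and $\alpha_{i_1\cdots i_\ell}=0$ for all index tuples $(i_1,\dots,i_\ell)$ with $|\{j: i_j>s\}|\ge 2$, then $(\pi,L)$ satisfies the $\mathcal{C}$-condition. (C) If $L=\{(0,\dots,0,x_{s+1},\dots,x_m):x_i\in\mathbb{F}_2\}$ and $\alpha_{i_1\cdots i_\ell}=1$ for some index tuple $(i_1,\dots,i_\ell)$ with $|\{j:i_j>s\}|\ge 2$, then $(\pi,L)$ does not satisfy the $\mathcal{C}$-condition. Moreover, in cases (A) and (B), the function $f_{(\pi,L)}$ is a bent function (of the $\mathcal{C}$-class).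
   Context: $\mathbb{F}_2$ is the field with two elements; for $x,y\in\mathbb{F}_2^m$, $x\cdot y=\sum_i x_iy_i$. For an $\mathbb{F}_2$-subspace $L$ of $\mathbb{F}_2^m$, $L^\perp=\{y: x\cdot y=0\ \forall x\in L\}$ and $1_{L^\perp}$ is its indicator function. For a permutation $\pi$ of $\mathbb{F}_2^m$, $f_{(\pi,L)}:\mathbb{F}_2^m\times\mathbb{F}_2^m\to\mathbb{F}_2$ is $f_{(\pi,L)}(x,y)=x\cdot\pi(y)+1_{L^\perp}(x)$. The pair $(\pi,L)$ satisfies the $\mathcal{C}$-condition if for every $a\in\mathbb{F}_2^m$ the set $\pi^{-1}(a+L)$ is a flat (affine subspace) of $\mathbb{F}_2^m$. A Boolean function $f$ on $\mathbb{F}_2^{2m}$ is bent if $|\sum_{z}(-1)^{f(z)+u\cdot z}|=2^m$ for all $u\in\mathbb{F}_2^{2m}$ (equivalently, for $2m>2$, its support is a difference set in $\mathbb{F}_2^{2m}$ with parameters $(2^{2m},2^{2m-1}\pm2^{m-1},2^{2m-2}\pm2^{m-1})$). *)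

theory Defs
  imports
    "HOL-Library.Z2"
    "HOL-Library.Indicator_Function"
    "Jordan_Normal_Form.VS_Connect"
begin

text \<open>
  \<^typ>\<open>bit\<close> is the field with two elements and \<^term>\<open>carrier_vec m :: bit vec set\<close> is its
  \<^term>\<open>m\<close>-fold power. Coordinates of vectors are counted from 0 by the library, so the
  mathematical coordinate \<open>x_i\<close> with \<open>1 \<le> i \<le> m\<close> is \<open>x $ (i - 1)\<close>.
\<close>

definition linear_subspace :: "nat \<Rightarrow> bit vec set \<Rightarrow> bool" where
  "linear_subspace m L \<longleftrightarrow> subspace class_ring L (module_vec TYPE(bit) m)"

definition translate :: "bit vec \<Rightarrow> bit vec set \<Rightarrow> bit vec set" where
  "translate a L = (\<lambda>v. a + v) ` L"

definition flat :: "nat \<Rightarrow> bit vec set \<Rightarrow> bool" where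
  "flat m A \<longleftrightarrow> (\<exists>b \<in> carrier_vec m. \<exists>V. linear_subspace m V \<and> A = translate b V)"

definition perp :: "nat \<Rightarrow> bit vec set \<Rightarrow> bit vec set" where
  "perp m L = {y \<in> carrier_vec m. \<forall>x \<in> L. x \<bullet> y = 0}"

definition permutation_on :: "nat \<Rightarrow> (bit vec \<Rightarrow> bit vec) \<Rightarrow> bool" where
  "permutation_on m \<pi> \<longleftrightarrow> bij_betw \<pi> (carrier_vec m) (carrier_vec m)"

text \<open>Only the values of \<open>\<pi>\<close> on \<^term>\<open>carrier_vec m\<close> matter, so preimages are taken there.\<close>

definition C_condition :: "nat \<Rightarrow> (bit vec \<Rightarrow> bit vec) \<Rightarrow> bit vec set \<Rightarrow> bool" where
  "C_condition m \<pi> L \<longleftrightarrow>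
     (\<forall>a \<in> carrier_vec m. flat m {y \<in> carrier_vec m. \<pi> y \<in> translate a L})"

text \<open>
  A pair \<open>(x, y)\<close> of vectors of length \<open>m\<close> is identified with the concatenation
  \<open>z = x @\<^sub>v y\<close> of length \<open>2 * m\<close>.
\<close>

definition f_pair :: "nat \<Rightarrow> (bit vec \<Rightarrow> bit vec) \<Rightarrow> bit vec set \<Rightarrow> bit vec \<Rightarrow> bit" where
  "f_pair m \<pi> L z =
     (let x = vec_first z m; y = vec_last z m in x \<bullet> \<pi> y + indicator (perp m L) x)"

definition bent :: "nat \<Rightarrow> (bit vec \<Rightarrow> bit) \<Rightarrow> bool" where
  "bent m f \<longleftrightarrow>
     (\<forall>u \<in> carrier_vec (2 * m).
        \<bar>\<Sum>z \<in> carrier_vec (2 * m). (- 1 :: int) ^ of_bit (f z + u \<bullet> z)\<bar> = 2 ^ m)"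

definition C_class :: "nat \<Rightarrow> (bit vec \<Rightarrow> bit) set" where
  "C_class m =
     {f. \<exists>\<pi> L. permutation_on m \<pi> \<and> linear_subspace m L \<and> C_condition m \<pi> L \<and>
          (\<forall>z \<in> carrier_vec (2 * m). f z = f_pair m \<pi> L z)}"

text \<open>
  A strictly increasing index tuple \<open>2 \<le> i_1 < \<dots> < i_l \<le> m\<close> is encoded as the set
  \<open>I = {i_1, \<dots>, i_l} \<subseteq> {2..m}\<close>; values of \<open>\<alpha>\<close> at other sets are irrelevant.
\<close>

definition P_poly :: "nat \<Rightarrow> (nat set \<Rightarrow> bit) \<Rightarrow> bit vec \<Rightarrow> bit" where
  "P_poly m \<alpha> x =
     (\<Sum>l = 0..m - 1. \<Sum>I | I \<subseteq> {2..m} \<and> card I = l. \<alpha> I * (\<Prod>i\<in>I. x $ (i - 1)))"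

definition shear :: "nat \<Rightarrow> (nat set \<Rightarrow> bit) \<Rightarrow> bit vec \<Rightarrow> bit vec" where
  "shear m \<alpha> x = vec m (\<lambda>j. if j = 0 then x $ 0 + P_poly m \<alpha> x else x $ j)"

definition first_coords :: "nat \<Rightarrow> nat \<Rightarrow> bit vec set" where
  "first_coords m s = {x \<in> carrier_vec m. \<forall>i \<in> {s + 1..m}. x $ (i - 1) = 0}"

definition last_coords :: "nat \<Rightarrow> nat \<Rightarrow> bit vec set" where
  "last_coords m s = {x \<in> carrier_vec m. \<forall>i \<in> {1..s}. x $ (i - 1) = 0}"

end

theory Submission
  imports Defs
begin

text \<open>
  Over the two-element field a nonempty set is a flat iff it is closed under \<open>x + y + z\<close>. The
  preimages of \<open>a + L\<close> under the shear are cosets of \<open>L\<close> when \<open>L\<close> consists of the first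
  coordinates. When \<open>L\<close> consists of the last ones, they are graphs of \<open>P\<close> over the slices fixing
  the coordinates \<open>2, \<dots>, s\<close>, hence flats iff \<open>P\<close> is affine on every slice. This is clear
  if every monomial has at most one free variable; otherwise a minimal monomial with two free
  variables \<open>i, k\<close> makes the second derivative of \<open>P\<close> in the directions \<open>i, k\<close> nonzero.

  For bentness put \<open>\<chi>(a) = (-1)\<^sup>a\<close>. If \<open>e\<close> is the indicator function of \<open>L\<^sup>\<bottom>\<close>, then
  \<open>\<chi>(e(x)) = 1\<close> for \<open>x \<notin> L\<^sup>\<bottom>\<close> and \<open>1 - 2\<close> otherwise; summing over \<open>x\<close> first, the Walsh
  coefficient at \<open>(u, v)\<close> becomes \<open>2^m \<chi>(v \<bullet> c) - 2 |L\<^sup>\<bottom>| \<Sum>\<chi>(v \<bullet> y)\<close>, where \<open>\<pi> c = u\<close> and \<open>y\<close>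
  runs over the flat \<open>\<pi>\<^sup>-\<^sup>1(u + L)\<close>, which contains \<open>c\<close>. A character sum over a flat vanishes unless
  the character is constant there, so by \<open>|L| |L\<^sup>\<bottom>| = 2^m\<close> the total is \<open>\<plusminus>2^m\<close>.
\<close>

section \<open>Vectors, subspaces and flats over the two-element field\<close>

declare add_bit_eq_xor [simp del] mult_bit_eq_and [simp del]

lemma bit_add_self [simp]: "a + a = (0::bit)" "a + (a + b) = (b::bit)"
  by (cases a; cases b; simp)+

lemma bit_add_eq_0_iff: "a + b = 0 \<longleftrightarrow> a = (b::bit)"
  by (cases a; cases b; simp)

lemma UNIV_bit: "(UNIV::bit set) = {0, 1}"
  by (auto intro: bit.exhaust)

lemma finite_carrier_bit_vec: "finite (carrier_vec m :: bit vec set)"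
  and card_carrier_bit_vec: "card (carrier_vec m :: bit vec set) = 2 ^ m"
proof -
  have fin: "finite (UNIV::bit set)"
    by (simp add: UNIV_bit)
  have img: "carrier_vec m = vec_of_list ` {xs :: bit list. set xs \<subseteq> UNIV \<and> length xs = m}"
    (is "_ = _ ` ?X")
  proof
    show "carrier_vec m \<subseteq> vec_of_list ` ?X"
    proof
      fix v :: "bit vec" assume "v \<in> carrier_vec m"
      then show "v \<in> vec_of_list ` ?X"
        by (intro image_eqI[of _ _ "list_of_vec v"]) (simp_all add: vec_list)
    qed
    show "vec_of_list ` ?X \<subseteq> carrier_vec m"
      by (intro image_subsetI carrier_vecI) simp
  qed
  have inj: "inj_on vec_of_list ?X"
    by (rule inj_on_inverseI[where g = list_of_vec]) (rule list_vec)
  show "finite (carrier_vec m :: bit vec set)"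
    unfolding img by (intro finite_imageI finite_lists_length_eq fin)
  show "card (carrier_vec m :: bit vec set) = 2 ^ m"
    unfolding img card_image[OF inj] card_lists_length_eq[OF fin] by (simp add: UNIV_bit numeral_2_eq_2)
qed

lemma bit_vec_add_self [simp]: "(x :: bit vec) \<in> carrier_vec m \<Longrightarrow> x + x = 0\<^sub>v m"
  by (intro eq_vecI) auto

lemma bit_vec_add_add_self [simp]:
  "(x :: bit vec) \<in> carrier_vec m \<Longrightarrow> y \<in> carrier_vec m \<Longrightarrow> x + (x + y) = y"
  by (intro eq_vecI) auto

lemma inj_on_bit_vec_add: "b \<in> carrier_vec m \<Longrightarrow> inj_on (\<lambda>x :: bit vec. b + x) (carrier_vec m)"
  by (rule inj_on_inverseI[where g = "\<lambda>x. b + x"]) simp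

lemma bit_vec_add_eq_0_iff:
  fixes x y :: "bit vec"
  assumes "x \<in> carrier_vec m" "y \<in> carrier_vec m"
  shows "x + y = 0\<^sub>v m \<longleftrightarrow> x = y"
  using assms by (metis bit_vec_add_add_self bit_vec_add_self right_zero_vec)

text \<open>The only scalars are 0 and 1, so closure under scalar multiplication follows from
  containing the zero vector.\<close>

lemma linear_subspace_iff:
  "linear_subspace m V \<longleftrightarrow>
     V \<subseteq> carrier_vec m \<and> 0\<^sub>v m \<in> V \<and> (\<forall>x \<in> V. \<forall>y \<in> V. x + y \<in> V)"
proof
  assume "linear_subspace m V"
  then have "submodule class_ring V (module_vec TYPE(bit) m)"
    by (simp add: linear_subspace_def subspace_def)
  then show "V \<subseteq> carrier_vec m \<and> 0\<^sub>v m \<in> V \<and> (\<forall>x \<in> V. \<forall>y \<in> V. x + y \<in> V)"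
    by (auto simp: submodule_def module_vec_simps)
next
  assume V: "V \<subseteq> carrier_vec m \<and> 0\<^sub>v m \<in> V \<and> (\<forall>x \<in> V. \<forall>y \<in> V. x + y \<in> V)"
  have smult: "c \<cdot>\<^sub>v x \<in> V" if "x \<in> V" for c x
  proof -
    have x: "x \<in> carrier_vec m"
      using that V by auto
    show ?thesis
    proof (cases "c = 0")
      case True
      then have "c \<cdot>\<^sub>v x = 0\<^sub>v m"
        using x by (intro eq_vecI) auto
      then show ?thesis
        using V by simp
    next
      case False
      then show ?thesis
        using that by simp
    qed
  qed
  then show "linear_subspace m V"
    using V by (auto simp: linear_subspace_def subspace_def submodule_def module_vec_simps
        vec_vs vec_module)
qed

lemma mem_translate_iff:
  assumes "a \<in> carrier_vec m" "x \<in> carrier_vec m" "L \<subseteq> carrier_vec m"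
  shows "x \<in> translate a L \<longleftrightarrow> a + x \<in> L"
  using assms unfolding translate_def by (auto simp: subset_iff intro!: image_eqI[of _ _ "a + x"])

text \<open>In a sum of three points of \<open>b + V\<close> two of the three copies of
  \<open>b\<close> cancel. Conversely, for any \<open>b\<close> in \<open>A\<close> the closure
  property turns \<open>b + A\<close> into a subspace, and translating back by \<open>b\<close>
  recovers \<open>A\<close>.\<close>

lemma flat_iff:
  "flat m A \<longleftrightarrow>
     A \<subseteq> carrier_vec m \<and> A \<noteq> {} \<and> (\<forall>x \<in> A. \<forall>y \<in> A. \<forall>z \<in> A. x + y + z \<in> A)"
proof
  assume "flat m A"
  then obtain b V where b: "b \<in> carrier_vec m" and V: "linear_subspace m V"
    and A: "A = translate b V"
    by (auto simp: flat_def)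
  have sub: "V \<subseteq> carrier_vec m"
    using V by (simp add: linear_subspace_iff)
  have "(b + x) + (b + y) + (b + z) \<in> A" if "x \<in> V" "y \<in> V" "z \<in> V" for x y z
  proof -
    have "(b + x) + (b + y) + (b + z) = b + (x + y + z)"
      using that[THEN subsetD[OF sub]] b by (intro eq_vecI) (auto simp: ac_simps)
    moreover have "x + y + z \<in> V"
      using that V by (simp add: linear_subspace_iff)
    ultimately show ?thesis
      by (auto simp: A translate_def)
  qed
  then show "A \<subseteq> carrier_vec m \<and> A \<noteq> {} \<and> (\<forall>x \<in> A. \<forall>y \<in> A. \<forall>z \<in> A. x + y + z \<in> A)"
    using b V sub by (auto simp: A translate_def linear_subspace_iff)
next
  assume A: "A \<subseteq> carrier_vec m \<and> A \<noteq> {} \<and> (\<forall>x \<in> A. \<forall>y \<in> A. \<forall>z \<in> A. x + y + z \<in> A)"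
  then obtain b where b: "b \<in> A" "b \<in> carrier_vec m"
    by auto
  have car: "x \<in> carrier_vec m" if "x \<in> A" for x
    using that A by auto
  have "(b + x) + (b + y) \<in> translate b A" if "x \<in> A" "y \<in> A" for x y
  proof -
    have "(b + x) + (b + y) = b + (b + x + y)"
      using b car[OF that(1)] car[OF that(2)] by (intro eq_vecI) (auto simp: ac_simps)
    then show ?thesis
      using A b that by (auto simp: translate_def)
  qed
  moreover have "translate b A \<subseteq> carrier_vec m"
    using b car by (auto simp: translate_def)
  moreover have "0\<^sub>v m \<in> translate b A"
    using b by (auto simp: translate_def intro!: image_eqI[of _ _ b])
  ultimately have "linear_subspace m (translate b A)"
    unfolding linear_subspace_iff by (auto simp: translate_def)
  moreover have "A = translate b (translate b A)"
  proof -
    have "(\<lambda>x. b + (b + x)) ` A = (\<lambda>x. x) ` A"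
      using b car by (intro image_cong) auto
    then show ?thesis
      by (simp add: translate_def image_image)
  qed
  ultimately show "flat m A"
    using b by (auto simp: flat_def)
qed

section \<open>Character sums and bentness\<close>

definition chi :: "bit \<Rightarrow> int" where
  "chi a = (- 1) ^ of_bit a"

lemma chi_simps [simp]: "chi 0 = 1" "chi 1 = - 1" "chi a * chi a = 1" "\<bar>chi a\<bar> = 1"
  by (cases a; simp add: chi_def)+

lemma chi_add: "chi (a + b) = chi a * chi b"
  by (cases a; cases b; simp add: chi_def)

text \<open>If some \<open>c\<close> in \<open>V\<close> has \<open>w \<bullet> c = 1\<close>,
  translation by \<open>c\<close> permutes \<open>V\<close> and flips the sign of every term, so the
  sum equals its own negative.\<close>

lemma sum_chi_subspace:
  assumes V: "linear_subspace m V" and w: "w \<in> carrier_vec m"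
  shows "(\<Sum>x\<in>V. chi (w \<bullet> x)) = (if \<forall>x\<in>V. w \<bullet> x = 0 then int (card V) else 0)"
proof (cases "\<forall>x\<in>V. w \<bullet> x = 0")
  case True
  then show ?thesis
    by simp
next
  case False
  then obtain c where c: "c \<in> V" "w \<bullet> c = 1"
    by auto
  have car: "x \<in> carrier_vec m" if "x \<in> V" for x
    using V that by (auto simp: linear_subspace_iff)
  have "bij_betw (\<lambda>x. c + x) V V"
    using V c car by (intro bij_betwI[where g = "\<lambda>x. c + x"]) (auto simp: linear_subspace_iff)
  then have "(\<Sum>x\<in>V. chi (w \<bullet> x)) = (\<Sum>x\<in>V. chi (w \<bullet> (c + x)))"
    by (rule sum.reindex_bij_betw[symmetric])
  also have "\<dots> = (\<Sum>x\<in>V. - chi (w \<bullet> x))"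
    using c w car by (intro sum.cong) (auto simp: scalar_prod_add_distrib[of _ m] chi_add)
  also have "\<dots> = - (\<Sum>x\<in>V. chi (w \<bullet> x))"
    by (simp add: sum_negf)
  finally show ?thesis
    using False by auto
qed

section \<open>Orthogonal complements\<close>

lemma linear_subspace_carrier: "linear_subspace m (carrier_vec m)"
  by (auto simp: linear_subspace_iff)

lemma linear_subspace_perp:
  assumes "L \<subseteq> carrier_vec m"
  shows "linear_subspace m (perp m L)"
  using assms
  by (auto simp: linear_subspace_iff perp_def subset_iff scalar_prod_add_distrib[of _ m])

lemma scalar_prod_nondegenerate:
  fixes w :: "bit vec"
  assumes "w \<in> carrier_vec m"
  shows "(\<forall>x\<in>carrier_vec m. w \<bullet> x = 0) \<longleftrightarrow> w = 0\<^sub>v m"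
proof
  assume h: "\<forall>x\<in>carrier_vec m. w \<bullet> x = 0"
  show "w = 0\<^sub>v m"
  proof (rule eq_vecI)
    fix i assume "i < dim_vec (0\<^sub>v m :: bit vec)"
    then show "w $ i = 0\<^sub>v m $ i"
      using h[rule_format, of "unit_vec m i"] assms by simp
  qed (use assms in auto)
qed auto

text \<open>Double counting of the sum of \<open>chi (x \<bullet> y)\<close> over \<open>x\<close>
  in \<open>L\<close> and all \<open>y\<close>: summing over \<open>y\<close> first leaves only
  \<open>x = 0\<close>, summing over \<open>x\<close> first leaves only the \<open>y\<close> in the
  complement.\<close>

lemma card_perp:
  assumes L: "linear_subspace m L"
  shows "card L * card (perp m L) = 2 ^ m"
proof -
  have sub: "L \<subseteq> carrier_vec m" and zero: "0\<^sub>v m \<in> L"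
    using L by (auto simp: linear_subspace_iff)
  have finL: "finite L"
    using sub finite_carrier_bit_vec by (rule finite_subset)
  have "(\<Sum>x\<in>L. \<Sum>y\<in>carrier_vec m. chi (x \<bullet> y)) = (\<Sum>x\<in>L. if x = 0\<^sub>v m then 2 ^ m else 0)"
  proof (rule sum.cong)
    fix x assume "x \<in> L"
    then have "x \<in> carrier_vec m"
      using sub by auto
    then show "(\<Sum>y\<in>carrier_vec m. chi (x \<bullet> y)) = (if x = 0\<^sub>v m then 2 ^ m else 0)"
      by (subst sum_chi_subspace[OF linear_subspace_carrier])
        (auto simp: scalar_prod_nondegenerate card_carrier_bit_vec)
  qed simp
  then have one: "(\<Sum>x\<in>L. \<Sum>y\<in>carrier_vec m. chi (x \<bullet> y)) = 2 ^ m"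
    using finL zero by simp
  have "(\<Sum>x\<in>L. \<Sum>y\<in>carrier_vec m. chi (x \<bullet> y)) = (\<Sum>y\<in>carrier_vec m. \<Sum>x\<in>L. chi (x \<bullet> y))"
    by (rule sum.swap)
  also have "\<dots> = (\<Sum>y\<in>carrier_vec m. if y \<in> perp m L then int (card L) else 0)"
  proof (rule sum.cong)
    fix y :: "bit vec" assume y: "y \<in> carrier_vec m"
    have comm: "x \<bullet> y = y \<bullet> x" if "x \<in> L" for x
      using that sub y by (intro comm_scalar_prod[of _ m]) auto
    have "(\<Sum>x\<in>L. chi (x \<bullet> y)) = (\<Sum>x\<in>L. chi (y \<bullet> x))"
      by (intro sum.cong) (simp_all add: comm)
    then show "(\<Sum>x\<in>L. chi (x \<bullet> y)) = (if y \<in> perp m L then int (card L) else 0)"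
      using y by (simp add: sum_chi_subspace[OF L y] perp_def comm)
  qed simp
  also have "\<dots> = (\<Sum>y\<in>carrier_vec m \<inter> perp m L. int (card L))"
    by (rule sum.inter_restrict[symmetric, OF finite_carrier_bit_vec])
  also have "carrier_vec m \<inter> perp m L = perp m L"
    by (auto simp: perp_def)
  also have "(\<Sum>y\<in>perp m L. int (card L)) = int (card L * card (perp m L))"
    by simp
  finally have "int (card L * card (perp m L)) = int (2 ^ m)"
    using one by simp
  then show ?thesis
    by (simp only: of_nat_eq_iff)
qed

text \<open>One inclusion is immediate, and applying \<open>card_perp\<close> to \<open>L\<close>
  and to its complement shows that both sides have the same finite cardinality.\<close>

lemma perp_perp:
  assumes L: "linear_subspace m L"
  shows "perp m (perp m L) = L"
proof -
  have sub: "L \<subseteq> carrier_vec m"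
    using L by (auto simp: linear_subspace_iff)
  have perp: "linear_subspace m (perp m L)"
    by (rule linear_subspace_perp[OF sub])
  have "card (perp m L) \<noteq> 0"
    using card_perp[OF L] by (metis mult_0_right power_not_zero zero_neq_numeral)
  moreover have "card (perp m L) * card (perp m (perp m L)) = card (perp m L) * card L"
    using card_perp[OF L] card_perp[OF perp] by (simp add: mult.commute)
  ultimately have "card L = card (perp m (perp m L))"
    by simp
  moreover have "L \<subseteq> perp m (perp m L)"
    using sub by (auto simp: perp_def subset_iff) (metis comm_scalar_prod)
  moreover have "finite (perp m (perp m L))"
    by (rule finite_subset[OF _ finite_carrier_bit_vec[of m]]) (auto simp: perp_def)
  ultimately show ?thesis
    by (metis card_subset_eq)
qed

text \<open>On \<open>b + V\<close> the character is a constant sign times its restriction to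
  \<open>V\<close>, so it either cancels or is constant. In the constant case its value can be read
  off at any point \<open>c\<close> of the flat.\<close>

lemma sum_chi_flat:
  assumes A: "flat m A" and v: "v \<in> carrier_vec m" and c: "c \<in> A"
  shows "(\<Sum>y\<in>A. chi (v \<bullet> y)) \<in> {0, int (card A) * chi (v \<bullet> c)}"
proof -
  obtain b V where b: "b \<in> carrier_vec m" and V: "linear_subspace m V"
    and AV: "A = translate b V"
    using A by (auto simp: flat_def)
  have car: "x \<in> carrier_vec m" if "x \<in> V" for x
    using V that by (auto simp: linear_subspace_iff)
  have inj: "inj_on (\<lambda>x. b + x) V"
    using inj_on_bit_vec_add[OF b] by (rule inj_on_subset) (auto simp: car)
  have "(\<Sum>y\<in>A. chi (v \<bullet> y)) = (\<Sum>x\<in>V. chi (v \<bullet> (b + x)))"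
    unfolding AV translate_def by (subst sum.reindex[OF inj]) simp
  also have "\<dots> = chi (v \<bullet> b) * (\<Sum>x\<in>V. chi (v \<bullet> x))"
    unfolding sum_distrib_left using b v car
    by (intro sum.cong) (auto simp: scalar_prod_add_distrib[of _ m] chi_add)
  finally have sum: "(\<Sum>y\<in>A. chi (v \<bullet> y)) = chi (v \<bullet> b) * (\<Sum>x\<in>V. chi (v \<bullet> x))" .
  show ?thesis
  proof (cases "\<forall>x\<in>V. v \<bullet> x = 0")
    case True
    have "v \<bullet> c = v \<bullet> b"
      using c b v car True by (auto simp: AV translate_def scalar_prod_add_distrib[of _ m])
    moreover have "card A = card V"
      unfolding AV translate_def by (rule card_image[OF inj])
    ultimately show ?thesis
      using True by (simp add: sum)
  next
    case False
    show ?thesis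
      unfolding sum sum_chi_subspace[OF V v] if_not_P[OF False] by simp
  qed
qed

section \<open>The Walsh transform of \<open>f_pair\<close>\<close>

lemma sum_carrier_vec_append:
  "(\<Sum>z\<in>carrier_vec (m + n). g z) =
     (\<Sum>y\<in>carrier_vec n. \<Sum>x\<in>carrier_vec m. g (x @\<^sub>v y))"
  for g :: "bit vec \<Rightarrow> int"
proof -
  have "(\<Sum>y\<in>carrier_vec n. \<Sum>x\<in>carrier_vec m. g (x @\<^sub>v y)) =
      (\<Sum>(y, x)\<in>carrier_vec n \<times> carrier_vec m. g (x @\<^sub>v y))"
    by (rule sum.cartesian_product)
  also have "\<dots> = (\<Sum>z\<in>carrier_vec (m + n). g z)"
    by (rule sum.reindex_bij_witness[where i = "\<lambda>z. (vec_last z n, vec_first z m)"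
          and j = "\<lambda>(y, x). x @\<^sub>v y"])
      (auto simp: vec_first_def vec_last_def intro!: eq_vecI)
  finally show ?thesis
    by simp
qed

theorem bent_f_pair:
  assumes \<pi>: "permutation_on m \<pi>" and L: "linear_subspace m L" and C: "C_condition m \<pi> L"
  shows "bent m (f_pair m \<pi> L)"
  unfolding bent_def
proof
  fix uv :: "bit vec" assume uv: "uv \<in> carrier_vec (2 * m)"
  define u v where "u = vec_first uv m" and "v = vec_last uv m"
  have u: "u \<in> carrier_vec m" and v: "v \<in> carrier_vec m" and uv_eq: "uv = u @\<^sub>v v"
    using uv by (auto simp: u_def v_def mult_2)
  have sub: "L \<subseteq> carrier_vec m"
    using L by (auto simp: linear_subspace_iff)
  have \<pi>_car: "\<pi> y \<in> carrier_vec m" if "y \<in> carrier_vec m" for y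
    using \<pi> that by (auto simp: permutation_on_def bij_betw_def)
  define A where "A = {y \<in> carrier_vec m. \<pi> y \<in> translate u L}"
  have A_iff: "y \<in> A \<longleftrightarrow> y \<in> carrier_vec m \<and> \<pi> y + u \<in> L" for y
    using mem_translate_iff[OF u _ sub] \<pi>_car u by (auto simp: A_def comm_add_vec[of _ m])
  have "flat m A"
    using C u by (simp add: C_condition_def A_def)
  obtain c where c: "c \<in> carrier_vec m" "\<pi> c = u"
    using \<pi> u by (metis bij_betw_iff_bijections permutation_on_def)
  have c_iff: "\<pi> y = u \<longleftrightarrow> y = c" if "y \<in> carrier_vec m" for y
    using \<pi> that c by (auto simp: permutation_on_def bij_betw_def inj_on_def)
  have cA: "c \<in> A"
    using c u L by (auto simp: A_iff linear_subspace_iff)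
  \<comment> \<open>This yields |A| = |L|, which later lets |A| times the size of the complement
    collapse to 2^m.\<close>
  have "bij_betw (\<lambda>y. u + \<pi> y) A L"
  proof (rule bij_betw_imageI)
    show "inj_on (\<lambda>y. u + \<pi> y) A"
    proof (rule comp_inj_on[of \<pi> _ "\<lambda>x. u + x", unfolded comp_def])
      show "inj_on \<pi> A"
        using \<pi> by (auto simp: permutation_on_def bij_betw_def A_def intro: inj_on_subset)
      show "inj_on (\<lambda>x. u + x) (\<pi> ` A)"
        using inj_on_bit_vec_add[OF u] by (rule inj_on_subset) (auto simp: A_def \<pi>_car)
    qed
    show "(\<lambda>y. u + \<pi> y) ` A = L"
    proof
      show "(\<lambda>y. u + \<pi> y) ` A \<subseteq> L"
        using u \<pi>_car by (auto simp: A_iff comm_add_vec[of u m])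
      show "L \<subseteq> (\<lambda>y. u + \<pi> y) ` A"
      proof
        fix x assume x: "x \<in> L"
        then have xc: "x \<in> carrier_vec m"
          using sub by auto
        then have "u + x \<in> \<pi> ` carrier_vec m"
          using \<pi> u by (auto simp: permutation_on_def bij_betw_def)
        then obtain y where y: "y \<in> carrier_vec m" "\<pi> y = u + x"
          by auto
        then have "u + \<pi> y = x"
          using u xc by simp
        moreover have "y \<in> A"
          using y x u xc by (simp add: A_def translate_def)
        ultimately show "x \<in> (\<lambda>y. u + \<pi> y) ` A"
          by auto
      qed
    qed
  qed
  then have cardA: "card A = card L"
    by (rule bij_betw_same_card)
  have subP: "perp m L \<subseteq> carrier_vec m"
    by (auto simp: perp_def)
  have inner: "(\<Sum>x\<in>carrier_vec m. chi (f_pair m \<pi> L (x @\<^sub>v y) + uv \<bullet> (x @\<^sub>v y))) =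
      chi (v \<bullet> y) * ((if y = c then 2 ^ m else 0) -
        2 * (if y \<in> A then int (card (perp m L)) else 0))"
    if y: "y \<in> carrier_vec m" for y
  proof -
    \<comment> \<open>For fixed \<open>y\<close> the exponent is
      \<open>w \<bullet> x + v \<bullet> y\<close> plus the indicator at \<open>x\<close>, so the
      sum over \<open>x\<close> is a character sum with frequency \<open>w\<close>.\<close>
    define w where "w = \<pi> y + u"
    have w: "w \<in> carrier_vec m"
      using \<pi>_car[OF y] u by (simp add: w_def)
    have "chi (f_pair m \<pi> L (x @\<^sub>v y) + uv \<bullet> (x @\<^sub>v y)) =
        chi (v \<bullet> y) * (chi (w \<bullet> x) - 2 * (if x \<in> perp m L then chi (w \<bullet> x) else 0))"
      if x: "x \<in> carrier_vec m" for x
    proof -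
      have "vec_first (x @\<^sub>v y) m = x" "vec_last (x @\<^sub>v y) m = y"
        using x y by (auto simp: vec_first_def vec_last_def intro!: eq_vecI)
      then have "f_pair m \<pi> L (x @\<^sub>v y) = x \<bullet> \<pi> y + indicator (perp m L) x"
        by (simp add: f_pair_def)
      moreover have "uv \<bullet> (x @\<^sub>v y) = u \<bullet> x + v \<bullet> y"
        unfolding uv_eq using u v x y by (rule scalar_prod_append)
      moreover have "w \<bullet> x = x \<bullet> \<pi> y + u \<bullet> x"
        unfolding w_def using x u \<pi>_car[OF y]
        by (simp add: add_scalar_prod_distrib[of _ m] comm_scalar_prod[of x m])
      ultimately show ?thesis
        by (auto simp: chi_add indicator_def)
    qed
    then have "(\<Sum>x\<in>carrier_vec m. chi (f_pair m \<pi> L (x @\<^sub>v y) + uv \<bullet> (x @\<^sub>v y))) =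
        chi (v \<bullet> y) * ((\<Sum>x\<in>carrier_vec m. chi (w \<bullet> x)) -
          2 * (\<Sum>x\<in>carrier_vec m. if x \<in> perp m L then chi (w \<bullet> x) else 0))"
      unfolding sum_distrib_left sum_subtractf[symmetric] by (intro sum.cong) simp_all
    also have "(\<Sum>x\<in>carrier_vec m. if x \<in> perp m L then chi (w \<bullet> x) else 0) =
        (\<Sum>x\<in>carrier_vec m \<inter> perp m L. chi (w \<bullet> x))"
      by (rule sum.inter_restrict[symmetric, OF finite_carrier_bit_vec])
    also have "carrier_vec m \<inter> perp m L = perp m L"
      using subP by auto
    \<comment> \<open>The character is trivial on the complement exactly when \<open>w\<close> lies
      in the double complement, which is \<open>L\<close>; this says that \<open>y\<close> is in
      \<open>A\<close>.\<close>
    also have "(\<Sum>x\<in>perp m L. chi (w \<bullet> x)) = (if y \<in> A then int (card (perp m L)) else 0)"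
    proof -
      have "(\<forall>x\<in>perp m L. w \<bullet> x = 0) \<longleftrightarrow> w \<in> perp m (perp m L)"
        using w subP by (auto simp: perp_def[of m "perp m L"] subset_iff comm_scalar_prod[of w m])
      also have "\<dots> \<longleftrightarrow> y \<in> A"
        using y by (simp add: perp_perp[OF L] A_iff w_def)
      finally show ?thesis
        by (simp add: sum_chi_subspace[OF linear_subspace_perp[OF sub] w])
    qed
    \<comment> \<open>The full sum survives only for \<open>w = 0\<close>, that is
      \<open>\<pi> y = u\<close>, which singles out \<open>y = c\<close>.\<close>
    also have "(\<Sum>x\<in>carrier_vec m. chi (w \<bullet> x)) = (if y = c then 2 ^ m else 0)"
    proof -
      have "w = 0\<^sub>v m \<longleftrightarrow> y = c"
        using bit_vec_add_eq_0_iff[OF \<pi>_car[OF y] u] c_iff[OF y] by (simp add: w_def)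
      then show ?thesis
        by (simp add: sum_chi_subspace[OF linear_subspace_carrier w]
            scalar_prod_nondegenerate[OF w] card_carrier_bit_vec)
    qed
    finally show ?thesis .
  qed
  have "(\<Sum>z\<in>carrier_vec (2 * m). chi (f_pair m \<pi> L z + uv \<bullet> z)) =
      (\<Sum>y\<in>carrier_vec m. chi (v \<bullet> y) * ((if y = c then 2 ^ m else 0) -
        2 * (if y \<in> A then int (card (perp m L)) else 0)))"
    unfolding mult_2 sum_carrier_vec_append by (intro sum.cong) (simp_all add: inner)
  also have "\<dots> = (\<Sum>y\<in>carrier_vec m. if y = c then chi (v \<bullet> y) * 2 ^ m else 0) -
      2 * int (card (perp m L)) * (\<Sum>y\<in>carrier_vec m. if y \<in> A then chi (v \<bullet> y) else 0)"
    unfolding sum_distrib_left sum_subtractf[symmetric]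
    by (intro sum.cong) (auto simp: algebra_simps)
  also have "(\<Sum>y\<in>carrier_vec m. if y = c then chi (v \<bullet> y) * 2 ^ m else 0) = chi (v \<bullet> c) * 2 ^ m"
    using c by (simp add: finite_carrier_bit_vec)
  also have "(\<Sum>y\<in>carrier_vec m. if y \<in> A then chi (v \<bullet> y) else 0) = (\<Sum>y\<in>A. chi (v \<bullet> y))"
    by (subst sum.inter_restrict[symmetric, OF finite_carrier_bit_vec])
      (auto simp: A_def intro!: sum.cong)
  finally have walsh: "(\<Sum>z\<in>carrier_vec (2 * m). chi (f_pair m \<pi> L z + uv \<bullet> z)) =
      chi (v \<bullet> c) * 2 ^ m - 2 * int (card (perp m L)) * (\<Sum>y\<in>A. chi (v \<bullet> y))" .
  have "int (card L) * int (card (perp m L)) = 2 ^ m"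
    using card_perp[OF L] by (metis of_nat_mult of_nat_numeral of_nat_power)
  \<comment> \<open>If the sum over \<open>A\<close> does not vanish, the subtracted term is twice
    the main term, so the difference is the main term with opposite sign.\<close>
  then have "2 * int (card (perp m L)) * (int (card A) * chi (v \<bullet> c)) = 2 * chi (v \<bullet> c) * 2 ^ m"
    by (simp add: cardA algebra_simps)
  with walsh sum_chi_flat[OF \<open>flat m A\<close> v cA]
  have "(\<Sum>z\<in>carrier_vec (2 * m). chi (f_pair m \<pi> L z + uv \<bullet> z)) \<in>
      {chi (v \<bullet> c) * 2 ^ m, - (chi (v \<bullet> c) * 2 ^ m)}"
    by auto
  then have "\<bar>\<Sum>z\<in>carrier_vec (2 * m). chi (f_pair m \<pi> L z + uv \<bullet> z)\<bar> = 2 ^ m"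
    by (auto simp: abs_mult)
  then show "\<bar>\<Sum>z\<in>carrier_vec (2 * m). (- 1 :: int) ^ of_bit (f_pair m \<pi> L z + uv \<bullet> z)\<bar> = 2 ^ m"
    by (simp only: chi_def)
qed

section \<open>The shear\<close>

text \<open>The outer sum only sorts the index sets by cardinality; a subset of
  \<open>{2..m}\<close> has at most m - 1 elements, so no monomial is lost.\<close>

lemma P_poly_altdef:
  assumes "m \<ge> 1"
  shows "P_poly m \<alpha> x = (\<Sum>I\<in>Pow {2..m}. \<alpha> I * (\<Prod>i\<in>I. x $ (i - 1)))"
proof -
  have "card I \<le> m - 1" if "I \<subseteq> {2..m}" for I
    using card_mono[OF _ that] by simp
  then have "(\<Sum>l\<in>{0..m - 1}. \<Sum>I | I \<in> Pow {2..m} \<and> card I = l. \<alpha> I * (\<Prod>i\<in>I. x $ (i - 1))) =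
      (\<Sum>I\<in>Pow {2..m}. \<alpha> I * (\<Prod>i\<in>I. x $ (i - 1)))"
    by (intro sum.group) auto
  then show ?thesis
    by (simp add: P_poly_def)
qed

text \<open>The index sets avoid 1, so \<open>P_poly\<close> never reads coordinate 0, the only one
  the shear changes.\<close>

lemma P_poly_cong:
  assumes "\<And>j. 1 \<le> j \<Longrightarrow> j < m \<Longrightarrow> x $ j = y $ j"
  shows "P_poly m \<alpha> x = P_poly m \<alpha> y"
  unfolding P_poly_def
proof (intro sum.cong refl arg_cong2[where f = "(*)"] prod.cong)
  fix l I i assume "I \<in> {I. I \<subseteq> {2..m} \<and> card I = l}" "i \<in> I"
  then have "i \<in> {2..m}"
    by auto
  then show "x $ (i - 1) = y $ (i - 1)"
    by (intro assms) auto
qed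

lemma shear_carrier [simp]: "shear m \<alpha> x \<in> carrier_vec m"
  by (simp add: shear_def)

lemma dim_shear [simp]: "dim_vec (shear m \<alpha> x) = m"
  by (simp add: shear_def)

lemma shear_index:
  "j < m \<Longrightarrow> shear m \<alpha> x $ j = (if j = 0 then x $ 0 + P_poly m \<alpha> x else x $ j)"
  by (simp add: shear_def)

text \<open>Both applications add the same value of \<open>P_poly\<close> to coordinate 0, and it
  cancels in characteristic two. Hence the shear is its own inverse.\<close>

lemma shear_shear:
  assumes "x \<in> carrier_vec m"
  shows "shear m \<alpha> (shear m \<alpha> x) = x"
proof -
  have "P_poly m \<alpha> (shear m \<alpha> x) = P_poly m \<alpha> x"
    by (rule P_poly_cong) (simp add: shear_index)
  then show ?thesis
    using assms by (intro eq_vecI) (auto simp: shear_index ac_simps shear_def)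
qed

lemma permutation_on_shear: "permutation_on m (shear m \<alpha>)"
  unfolding permutation_on_def
  by (rule bij_betwI[where g = "shear m \<alpha>"]) (auto simp: shear_shear)

section \<open>Coordinate subspaces and the C-condition for the shear\<close>

lemma first_coords_iff:
  "x \<in> first_coords m s \<longleftrightarrow> x \<in> carrier_vec m \<and> (\<forall>j. s \<le> j \<and> j < m \<longrightarrow> x $ j = 0)"
proof -
  have "(\<forall>i\<in>{s + 1..m}. x $ (i - 1) = 0) \<longleftrightarrow> (\<forall>j. s \<le> j \<and> j < m \<longrightarrow> x $ j = 0)"
  proof safe
    fix j assume "\<forall>i\<in>{s + 1..m}. x $ (i - 1) = 0" "s \<le> j" "j < m"
    then show "x $ j = 0"
      by (auto dest: bspec[of _ _ "Suc j"])
  next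
    fix i assume "\<forall>j. s \<le> j \<and> j < m \<longrightarrow> x $ j = 0" "i \<in> {s + 1..m}"
    then show "x $ (i - 1) = 0"
      by (auto dest: spec[of _ "i - 1"])
  qed
  then show ?thesis
    by (simp add: first_coords_def)
qed

lemma last_coords_iff:
  "x \<in> last_coords m s \<longleftrightarrow> x \<in> carrier_vec m \<and> (\<forall>j<s. x $ j = 0)"
proof -
  have "(\<forall>i\<in>{1..s}. x $ (i - 1) = 0) \<longleftrightarrow> (\<forall>j<s. x $ j = 0)"
  proof safe
    fix j assume "\<forall>i\<in>{1..s}. x $ (i - 1) = 0" "j < s"
    then show "x $ j = 0"
      by (auto dest: bspec[of _ _ "Suc j"])
  qed auto
  then show ?thesis
    by (simp add: last_coords_def)
qed

lemma linear_subspace_first_coords: "linear_subspace m (first_coords m s)"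
  by (auto simp: linear_subspace_iff first_coords_iff)

lemma linear_subspace_last_coords:
  assumes "s \<le> m"
  shows "linear_subspace m (last_coords m s)"
  using assms by (auto simp: linear_subspace_iff last_coords_iff)

text \<open>Surjectivity of \<pi> makes every preimage nonempty, so only the closure test of
  \<open>flat_iff\<close> remains. Since a = -a, lying in the coset a + L is tested by adding
  \<open>a\<close>.\<close>

lemma C_condition_iff:
  assumes L: "linear_subspace m L" and \<pi>: "permutation_on m \<pi>"
  shows "C_condition m \<pi> L \<longleftrightarrow>
    (\<forall>a\<in>carrier_vec m. \<forall>x\<in>carrier_vec m. \<forall>y\<in>carrier_vec m. \<forall>z\<in>carrier_vec m.
       a + \<pi> x \<in> L \<longrightarrow> a + \<pi> y \<in> L \<longrightarrow> a + \<pi> z \<in> L \<longrightarrow> a + \<pi> (x + y + z) \<in> L)"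
proof -
  have sub: "L \<subseteq> carrier_vec m"
    using L by (simp add: linear_subspace_iff)
  have \<pi>_car: "\<pi> y \<in> carrier_vec m" if "y \<in> carrier_vec m" for y
    using \<pi> that by (auto simp: permutation_on_def bij_betw_def)
  have "{y \<in> carrier_vec m. \<pi> y \<in> translate a L} \<noteq> {}" if a: "a \<in> carrier_vec m" for a
  proof -
    obtain c where "c \<in> carrier_vec m" "\<pi> c = a"
      using \<pi> a by (metis bij_betw_iff_bijections permutation_on_def)
    then show ?thesis
      using mem_translate_iff[OF a a sub] L a by (auto simp: linear_subspace_iff)
  qed
  moreover have "\<pi> y \<in> translate a L \<longleftrightarrow> a + \<pi> y \<in> L"
    if "a \<in> carrier_vec m" "y \<in> carrier_vec m" for a y
    using that by (intro mem_translate_iff[OF _ _ sub] \<pi>_car)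
  ultimately show ?thesis
    unfolding C_condition_def flat_iff by (auto 0 4)
qed

text \<open>As s is at least 1, \<open>first_coords\<close> leaves coordinate 0 free, so the shear
  moves points only within cosets and each preimage is the coset itself.\<close>

lemma C_condition_first_coords:
  assumes "s \<ge> 1"
  shows "C_condition m (shear m \<alpha>) (first_coords m s)"
proof -
  have "a + shear m \<alpha> x \<in> first_coords m s \<longleftrightarrow> a + x \<in> first_coords m s"
    if "a \<in> carrier_vec m" "x \<in> carrier_vec m" for a x
    using that assms
    by (auto simp: first_coords_iff shear_index)
  then show ?thesis
    unfolding C_condition_iff[OF linear_subspace_first_coords permutation_on_shear]
    by (auto simp: first_coords_iff bit_add_eq_0_iff)
qed

text \<open>The right-hand side says that \<open>P_poly\<close> is affine on each slice. In
  zero-based counting the fixed coordinates 1 to s - 1 are the variables with indices 2 to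
  s.\<close>

lemma C_condition_last_coords_iff:
  assumes "1 \<le> s" "s \<le> m"
  shows "C_condition m (shear m \<alpha>) (last_coords m s) \<longleftrightarrow>
    (\<forall>x\<in>carrier_vec m. \<forall>y\<in>carrier_vec m. \<forall>z\<in>carrier_vec m.
       (\<forall>j. 1 \<le> j \<and> j < s \<longrightarrow> y $ j = x $ j \<and> z $ j = x $ j) \<longrightarrow>
       P_poly m \<alpha> (x + y + z) = P_poly m \<alpha> x + P_poly m \<alpha> y + P_poly m \<alpha> z)"
    (is "_ \<longleftrightarrow> ?R")
proof -
  \<comment> \<open>The preimage is a graph: coordinates 1 to s - 1 are prescribed by
    \<open>a\<close>, and coordinate 0 is then determined as \<open>a $ 0\<close> plus the value of
    \<open>P_poly\<close>.\<close>
  have mem: "a + shear m \<alpha> x \<in> last_coords m s \<longleftrightarrow>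
      a $ 0 = x $ 0 + P_poly m \<alpha> x \<and> (\<forall>j. 1 \<le> j \<and> j < s \<longrightarrow> a $ j = x $ j)"
    if "a \<in> carrier_vec m" "x \<in> carrier_vec m" for a x
  proof -
    have "a + shear m \<alpha> x \<in> last_coords m s \<longleftrightarrow> (\<forall>j<s. a $ j = shear m \<alpha> x $ j)"
      using that assms
      by (auto simp: last_coords_iff bit_add_eq_0_iff)
    also have "\<dots> \<longleftrightarrow> a $ 0 = x $ 0 + P_poly m \<alpha> x \<and> (\<forall>j. 1 \<le> j \<and> j < s \<longrightarrow> a $ j = x $ j)"
      using assms by (auto simp: shear_index)
    finally show ?thesis .
  qed
  note C_iff = C_condition_iff[OF linear_subspace_last_coords[OF assms(2)] permutation_on_shear]
  show ?thesis
  proof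
    assume C: "C_condition m (shear m \<alpha>) (last_coords m s)"
    show ?R
    proof (intro ballI impI)
      fix x y z :: "bit vec"
      assume car: "x \<in> carrier_vec m" "y \<in> carrier_vec m" "z \<in> carrier_vec m"
        and eq: "\<forall>j. 1 \<le> j \<and> j < s \<longrightarrow> y $ j = x $ j \<and> z $ j = x $ j"
      \<comment> \<open>\<open>P\<close> ignores the coordinate 0, so it can be set to bring the points into one preimage.\<close>
      define lift where "lift = (\<lambda>w. vec m (\<lambda>j. if j = 0 then P_poly m \<alpha> w else w $ j))"
      define a where "a = vec m (\<lambda>j. if j = 0 then 0 else x $ j)"
      have P_lift: "P_poly m \<alpha> (lift w) = P_poly m \<alpha> w" for w
        by (rule P_poly_cong) (simp add: lift_def)
      have lift_car: "lift w \<in> carrier_vec m" for w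
        by (simp add: lift_def)
      have a: "a \<in> carrier_vec m"
        by (simp add: a_def)
      \<comment> \<open>Coordinate 0 of the sheared lift is \<open>P_poly m \<alpha> w\<close> added
        to itself, hence 0, as in \<open>a\<close>.\<close>
      have "a + shear m \<alpha> (lift w) \<in> last_coords m s" if "w \<in> {x, y, z}" for w
        unfolding mem[OF a lift_car] P_lift using assms eq that
        by (auto simp: a_def lift_def)
      then have "a + shear m \<alpha> (lift x + lift y + lift z) \<in> last_coords m s"
        using C[unfolded C_iff] a lift_car by blast
      then have "a $ 0 = (lift x + lift y + lift z) $ 0 + P_poly m \<alpha> (lift x + lift y + lift z)"
        using mem[OF a, of "lift x + lift y + lift z"] lift_car by simp
      moreover have "P_poly m \<alpha> (lift x + lift y + lift z) = P_poly m \<alpha> (x + y + z)"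
        using car by (intro P_poly_cong) (simp add: lift_def)
      ultimately have "0 = P_poly m \<alpha> x + P_poly m \<alpha> y + P_poly m \<alpha> z + P_poly m \<alpha> (x + y + z)"
        using assms by (simp add: a_def lift_def add.assoc)
      then show "P_poly m \<alpha> (x + y + z) = P_poly m \<alpha> x + P_poly m \<alpha> y + P_poly m \<alpha> z"
        by (metis bit_add_eq_0_iff)
    qed
  next
    assume R: ?R
    show "C_condition m (shear m \<alpha>) (last_coords m s)"
      unfolding C_iff
    proof (intro ballI impI)
      fix a x y z :: "bit vec"
      assume car: "a \<in> carrier_vec m" "x \<in> carrier_vec m" "y \<in> carrier_vec m" "z \<in> carrier_vec m"
        and h: "a + shear m \<alpha> x \<in> last_coords m s" "a + shear m \<alpha> y \<in> last_coords m s"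
          "a + shear m \<alpha> z \<in> last_coords m s"
      note h = h[unfolded mem[OF car(1,2)] mem[OF car(1,3)] mem[OF car(1,4)]]
      have P: "P_poly m \<alpha> (x + y + z) = P_poly m \<alpha> x + P_poly m \<alpha> y + P_poly m \<alpha> z"
        using R car h by simp
      \<comment> \<open>Writing \<open>a $ 0\<close> three times allows the graph equations of the
        three points to be added.\<close>
      have "a $ 0 = a $ 0 + a $ 0 + a $ 0"
        by simp
      also have "\<dots> = (x $ 0 + P_poly m \<alpha> x) + (y $ 0 + P_poly m \<alpha> y) + (z $ 0 + P_poly m \<alpha> z)"
        using h by simp
      also have "\<dots> = (x + y + z) $ 0 + P_poly m \<alpha> (x + y + z)"
        unfolding P using car assms by (simp add: ac_simps)
      finally have "a $ 0 = (x + y + z) $ 0 + P_poly m \<alpha> (x + y + z)" .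
      moreover have "\<forall>j. 1 \<le> j \<and> j < s \<longrightarrow> a $ j = (x + y + z) $ j"
      proof (intro allI impI)
        fix j assume j: "1 \<le> j \<and> j < s"
        then have "x $ j = a $ j" "y $ j = a $ j" "z $ j = a $ j"
          using h by simp_all
        then show "a $ j = (x + y + z) $ j"
          using car assms j by simp
      qed
      ultimately show "a + shear m \<alpha> (x + y + z) \<in> last_coords m s"
        using car by (simp add: mem)
    qed
  qed
qed

text \<open>On a slice the variables with index at most s contribute a common constant
  \<open>c\<close>. With at most one free variable the monomial is \<open>c\<close> or
  \<open>c\<close> times a coordinate; the former is additive because c + c + c = c.\<close>

lemma monomial_add3:
  fixes x y z :: "bit vec"
  assumes car: "x \<in> carrier_vec m" "y \<in> carrier_vec m" "z \<in> carrier_vec m"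
    and eq: "\<forall>j. 1 \<le> j \<and> j < s \<longrightarrow> y $ j = x $ j \<and> z $ j = x $ j"
    and I: "I \<subseteq> {2..m}" and card: "card {i \<in> I. i > s} < 2"
  shows "(\<Prod>i\<in>I. (x + y + z) $ (i - 1)) =
    (\<Prod>i\<in>I. x $ (i - 1)) + (\<Prod>i\<in>I. y $ (i - 1)) + (\<Prod>i\<in>I. z $ (i - 1))"
proof -
  define J where "J = {i \<in> I. i \<le> s}"
  define c where "c = (\<Prod>i\<in>J. x $ (i - 1))"
  have fin: "finite I"
    using I finite_subset by blast
  have idx: "1 \<le> i - 1" "i - 1 < s" "i - 1 < m" if "i \<in> J" for i
  proof -
    have "2 \<le> i" "i \<le> m" "i \<le> s"
      using that I by (auto simp: J_def)
    then show "1 \<le> i - 1" "i - 1 < s" "i - 1 < m"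
      by auto
  qed
  have cs: "(\<Prod>i\<in>J. y $ (i - 1)) = c" "(\<Prod>i\<in>J. z $ (i - 1)) = c"
    "(\<Prod>i\<in>J. (x + y + z) $ (i - 1)) = c"
    unfolding c_def using idx eq car by (auto intro!: prod.cong)
  have "card {i \<in> I. i > s} = 0 \<or> card {i \<in> I. i > s} = 1"
    using card by linarith
  then consider "{i \<in> I. i > s} = {}" | k where "{i \<in> I. i > s} = {k}"
    using fin by (auto simp: card_1_singleton_iff)
  then show ?thesis
  proof cases
    case 1
    then have "I = J"
      by (auto simp: J_def not_less)
    show ?thesis
      unfolding \<open>I = J\<close> cs c_def[symmetric] by simp
  next
    case (2 k)
    have "k \<in> {i \<in> I. i > s}"
      by (simp only: 2 singletonI)
    then have k: "k \<in> I" "k \<notin> J"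
      by (simp_all add: J_def)
    have "I = {i \<in> I. i > s} \<union> J"
      by (auto simp: J_def)
    then have IJ: "I = insert k J"
      by (simp only: 2 insert_is_Un[symmetric])
    have "k - 1 < m"
      using subsetD[OF I k(1)] by auto
    then have "(x + y + z) $ (k - 1) = x $ (k - 1) + y $ (k - 1) + z $ (k - 1)"
      using car by simp
    moreover have "(\<Prod>i\<in>I. f i) = f k * (\<Prod>i\<in>J. f i)" for f :: "nat \<Rightarrow> bit"
      using k(2) fin by (subst IJ, subst prod.insert) (simp_all add: J_def)
    ultimately show ?thesis
      by (simp only: cs distrib_right flip: c_def)
  qed
qed

lemma C_condition_last_coords:
  assumes s: "1 \<le> s" "s \<le> m"
    and \<alpha>: "\<And>I. I \<subseteq> {2..m} \<Longrightarrow> card {i \<in> I. i > s} \<ge> 2 \<Longrightarrow> \<alpha> I = 0"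
  shows "C_condition m (shear m \<alpha>) (last_coords m s)"
  unfolding C_condition_last_coords_iff[OF s]
proof (intro ballI impI)
  fix x y z :: "bit vec"
  assume h: "x \<in> carrier_vec m" "y \<in> carrier_vec m" "z \<in> carrier_vec m"
    "\<forall>j. 1 \<le> j \<and> j < s \<longrightarrow> y $ j = x $ j \<and> z $ j = x $ j"
  have m: "m \<ge> 1"
    using s by simp
  show "P_poly m \<alpha> (x + y + z) = P_poly m \<alpha> x + P_poly m \<alpha> y + P_poly m \<alpha> z"
    unfolding P_poly_altdef[OF m] sum.distrib[symmetric]
  proof (rule sum.cong)
    fix I assume "I \<in> Pow {2..m}"
    then have I: "I \<subseteq> {2..m}"
      by simp
    show "\<alpha> I * (\<Prod>i\<in>I. (x + y + z) $ (i - 1)) = \<alpha> I * (\<Prod>i\<in>I. x $ (i - 1)) +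
        \<alpha> I * (\<Prod>i\<in>I. y $ (i - 1)) + \<alpha> I * (\<Prod>i\<in>I. z $ (i - 1))"
    proof (cases "card {i \<in> I. i > s} < 2")
      case True
      show ?thesis
        unfolding monomial_add3[OF h I True] by (simp add: algebra_simps)
    next
      case False
      then show ?thesis
        using \<alpha>[OF I] by simp
    qed
  qed simp
qed

lemma not_C_condition_last_coords:
  assumes s: "1 \<le> s" "s \<le> m"
    and ex: "\<exists>I. I \<subseteq> {2..m} \<and> card {i \<in> I. i > s} \<ge> 2 \<and> \<alpha> I = 1"
  shows "\<not> C_condition m (shear m \<alpha>) (last_coords m s)"
proof
  assume C: "C_condition m (shear m \<alpha>) (last_coords m s)"
  have m: "m \<ge> 1"
    using s by simp
  define Q where "Q = (\<lambda>I. I \<subseteq> {2..m} \<and> card {i \<in> I. i > s} \<ge> 2 \<and> \<alpha> I = 1)"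
  have "\<exists>I. Q I"
    using ex by (simp add: Q_def)
  \<comment> \<open>Minimality is taken among the monomials of \<open>P_poly\<close> with at least
    two free variables, so smaller ones cannot interfere below.\<close>
  then obtain I where "Q I" and min: "\<And>K. Q K \<Longrightarrow> card I \<le> card K"
    using ex_has_least_nat[of Q _ card] by blast
  then have I: "I \<subseteq> {2..m}" "card {i \<in> I. i > s} \<ge> 2" "\<alpha> I = 1"
    by (simp_all add: Q_def)
  have fin: "finite I"
    using I finite_subset by blast
  obtain i k where ik: "i \<in> I" "k \<in> I" "i > s" "k > s" "i \<noteq> k"
    using I(2) fin by (auto simp: numeral_2_eq_2 card_le_Suc_iff)
  \<comment> \<open>The indicator vector of \<open>J\<close>, shifted because variable i is stored
    at position i - 1. At this point the monomial of \<open>K\<close> has value 1 exactly when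
    \<open>K\<close> is contained in \<open>J\<close>.\<close>
  define ind where "ind = (\<lambda>J. vec m (\<lambda>j. of_bool (Suc j \<in> J) :: bit))"
  have P_ind: "P_poly m \<alpha> (ind J) = (\<Sum>K\<in>Pow {2..m}. \<alpha> K * of_bool (K \<subseteq> J))" for J
    unfolding P_poly_altdef[OF m]
  proof (intro sum.cong refl arg_cong2[where f = "(*)"])
    fix K assume K: "K \<in> Pow {2..m}"
    then have "finite K"
      using finite_subset by auto
    have "(\<Prod>i\<in>K. ind J $ (i - 1)) = (\<Prod>i\<in>K. of_bool (i \<in> J))"
    proof (rule prod.cong)
      fix i assume "i \<in> K"
      then have "2 \<le> i" "i \<le> m"
        using K by auto
      then show "ind J $ (i - 1) = of_bool (i \<in> J)"
        by (simp add: ind_def)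
    qed simp
    also have "\<dots> = of_bool (K \<subseteq> J)"
      using \<open>finite K\<close> by (induction K) auto
    finally show "(\<Prod>i\<in>K. ind J $ (i - 1)) = of_bool (K \<subseteq> J)" .
  qed
  \<comment> \<open>Positions belonging to \<open>i\<close> and \<open>k\<close> are covered once,
    those of the rest of \<open>I\<close> three times, which is odd in either case.\<close>
  have "ind (I - {k}) + ind (I - {i}) + ind (I - {i, k}) = ind I"
    using ik by (intro eq_vecI) (auto simp: ind_def)
  \<comment> \<open>The three points lie in one slice because \<open>i\<close> and \<open>k\<close>
    exceed s.\<close>
  moreover have "P_poly m \<alpha> (ind (I - {k}) + ind (I - {i}) + ind (I - {i, k})) =
      P_poly m \<alpha> (ind (I - {k})) + P_poly m \<alpha> (ind (I - {i})) + P_poly m \<alpha> (ind (I - {i, k}))"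
    by (rule C[unfolded C_condition_last_coords_iff[OF s], rule_format])
      (use ik s in \<open>auto simp: ind_def\<close>)
  ultimately have "0 = P_poly m \<alpha> (ind I) + (P_poly m \<alpha> (ind (I - {k})) +
      P_poly m \<alpha> (ind (I - {i})) + P_poly m \<alpha> (ind (I - {i, k})))"
    by simp
  also have "\<dots> = (\<Sum>K\<in>Pow {2..m}. \<alpha> K * (of_bool (K \<subseteq> I) + (of_bool (K \<subseteq> I - {k}) +
      of_bool (K \<subseteq> I - {i}) + of_bool (K \<subseteq> I - {i, k}))))"
    by (simp add: P_ind sum.distrib distrib_left)
  also have "\<dots> = (\<Sum>K\<in>Pow {2..m}. if K = I then 1 else 0)"
  proof (rule sum.cong)
    fix K assume K: "K \<in> Pow {2..m}"
    \<comment> \<open>Inclusion-exclusion modulo 2: the second derivative keeps exactly the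
      monomials inside \<open>I\<close> that contain both \<open>i\<close> and
      \<open>k\<close>.\<close>
    have eq: "of_bool (K \<subseteq> I) + (of_bool (K \<subseteq> I - {k}) + of_bool (K \<subseteq> I - {i}) +
        of_bool (K \<subseteq> I - {i, k})) = (of_bool (K \<subseteq> I \<and> i \<in> K \<and> k \<in> K) :: bit)"
      by (cases "K \<subseteq> I"; cases "i \<in> K"; cases "k \<in> K") (auto simp: subset_Diff_insert)
    \<comment> \<open>Such a \<open>K\<close> still has the two free indices \<open>i\<close> and
      \<open>k\<close> but is smaller than \<open>I\<close>, so a coefficient 1 would contradict
      minimality.\<close>
    have "\<alpha> K = 0" if "K \<subseteq> I" "i \<in> K" "k \<in> K" "K \<noteq> I"
    proof -
      have "card K < card I"
        using that fin by (intro psubset_card_mono) auto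
      then have "\<not> Q K"
        using min[of K] by auto
      moreover have "card {i, k} \<le> card {j \<in> K. j > s}"
        using that ik finite_subset[OF that(1) fin] by (intro card_mono) auto
      ultimately show ?thesis
        using K ik by (auto simp: Q_def)
    qed
    then show "\<alpha> K * (of_bool (K \<subseteq> I) + (of_bool (K \<subseteq> I - {k}) +
        of_bool (K \<subseteq> I - {i}) + of_bool (K \<subseteq> I - {i, k}))) = (if K = I then 1 else 0)"
      unfolding eq using I ik by auto
  qed simp
  also have "\<dots> = 1"
    using I by simp
  finally show False
    by simp
qed

theorem theorem4p1:
  fixes m s :: nat and \<alpha> :: "nat set \<Rightarrow> bit"
  assumes "m \<ge> 2" and "s \<in> {1..m}"
  shows "permutation_on m (shear m \<alpha>) \<and>
    linear_subspace m (first_coords m s) \<and>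
    linear_subspace m (last_coords m s) \<and>
    \<comment> \<open>(A)\<close>
    C_condition m (shear m \<alpha>) (first_coords m s) \<and>
    bent m (f_pair m (shear m \<alpha>) (first_coords m s)) \<and>
    f_pair m (shear m \<alpha>) (first_coords m s) \<in> C_class m \<and>
    \<comment> \<open>(B)\<close>
    ((\<forall>I. I \<subseteq> {2..m} \<and> card {i \<in> I. i > s} \<ge> 2 \<longrightarrow> \<alpha> I = 0) \<longrightarrow>
       C_condition m (shear m \<alpha>) (last_coords m s) \<and>
       bent m (f_pair m (shear m \<alpha>) (last_coords m s)) \<and>
       f_pair m (shear m \<alpha>) (last_coords m s) \<in> C_class m) \<and>
    \<comment> \<open>(C)\<close>
    ((\<exists>I. I \<subseteq> {2..m} \<and> card {i \<in> I. i > s} \<ge> 2 \<and> \<alpha> I = 1) \<longrightarrow>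
       \<not> C_condition m (shear m \<alpha>) (last_coords m s))"
proof -
  have s: "1 \<le> s" "s \<le> m"
    using assms by auto
  note perm = permutation_on_shear[of m \<alpha>]
  have good: "bent m (f_pair m (shear m \<alpha>) L) \<and> f_pair m (shear m \<alpha>) L \<in> C_class m"
    if "linear_subspace m L" "C_condition m (shear m \<alpha>) L" for L
    using bent_f_pair[OF perm that] perm that by (auto simp: C_class_def)
  note first = linear_subspace_first_coords[of m s] C_condition_first_coords[OF s(1), of m \<alpha>]
  note last = linear_subspace_last_coords[OF s(2)]
  show ?thesis
    using perm first good[OF first] last good[OF last] C_condition_last_coords[OF s, of \<alpha>]
      not_C_condition_last_coords[OF s, of \<alpha>] by blast
qed

end
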